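(* Let $A$ be a C*-algebra, and let $B\subset A$ be a norm-closed self-adjoint subalgebra. The assignment $n\mapsto BnB$ defines a map $\boldsymbol\sigma:N(B)\to\mathcal I_B$ which is a lax homomorphism of ordered semigroups, in the sense that $\boldsymbol\sigma(mn)\subset\boldsymbol\sigma(m)\boldsymbol\sigma(n)$ for all $m,n\in N(B)$, and which preserves the involution strictly, i.e. $\boldsymbol\sigma(n^* )=\boldsymbol\sigma(n)^*$. Furthermore, if $B$ contains an approximate unit of $A$ then the image of $\boldsymbol\sigma$ is join-dense in $\mathcal I_B$. If $B$ is commutative (not necessarily containing an approximate unit of $A$) then $\boldsymbol\sigma$ is a (strict) homomorphism of semigroups and $\boldsymbol\sigma(n)=nB=Bn$ for all $n\in N(B)$.
   Context: For a C*-algebra $A$, $\operatorname{Max}A$ is the set of closed linear subspaces of $A$ ordered by inclusion, with pointwise involution $V^*=\{a^*:a\in V\}$ and product $VW=\overline{\operatorname{span}}\{ab:a\in V,\ b\in W\}$; joins are closures of sums. The normalizer semigroup is $N(B)=\{n\in A: nBn^*\subset B\text{ and }n^*Bn\subset B\}$, an involutive subsemigroup of $A$. The pseudogroup $\mathcal I_B$ is the set of all $V\in\operatorname{Max}A$ with $V^*V\subset B$, $VV^*\subset B$, $VB\subset V$, $BV\subset V$; under the product of $\operatorname{Max}A$ it is an inverse semigroup with inverse $V\mapsto V^*$, unit $B$, and natural order given by inclusion. The expressions $BnB$, $nB$, $Bn$ are products in $\operatorname{Max}A$ with $n$ replaced by the line $\mathbb Cn$, i.e. $BnB=\overline{\operatorname{span}}\{bnb':b,b'\in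 B\}$, $nB=\overline{\{nb:b\in B\}}$, $Bn=\overline{\{bn:b\in B\}}$. A subset of $\mathcal I_B$ is join-dense if every element of $\mathcal I_B$ is a join of elements of the subset. *)

theory Defs
  imports "HOL-Analysis.Analysis"
begin

section \<open>C*-algebras\<close>

text \<open>
  A C*-algebra, not necessarily unital, is modelled as a type. The library provides Banach algebras
  over the reals; the class adds a compatible complex scalar multiplication and the involution.
\<close>

class cstar_algebra = real_normed_algebra + banach +
  fixes scaleC :: "complex \<Rightarrow> 'a \<Rightarrow> 'a" (infixr "*\<^sub>C" 75)
    and star :: "'a \<Rightarrow> 'a"
  assumes scaleC_add_right: "c *\<^sub>C (x + y) = c *\<^sub>C x + c *\<^sub>C y"
    and scaleC_add_left: "(c + d) *\<^sub>C x = c *\<^sub>C x + d *\<^sub>C x"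
    and scaleC_scaleC: "c *\<^sub>C (d *\<^sub>C x) = (c * d) *\<^sub>C x"
    and scaleC_one: "1 *\<^sub>C x = x"
    and scaleR_scaleC: "scaleR r x = complex_of_real r *\<^sub>C x"
    and norm_scaleC: "norm (c *\<^sub>C x) = cmod c * norm x"
    and mult_scaleC_left: "(c *\<^sub>C x) * y = c *\<^sub>C (x * y)"
    and mult_scaleC_right: "x * (c *\<^sub>C y) = c *\<^sub>C (x * y)"
    and star_star: "star (star x) = x"
    and star_add: "star (x + y) = star x + star y"
    and star_scaleC: "star (c *\<^sub>C x) = cnj c *\<^sub>C star x"
    and star_mult: "star (x * y) = star y * star x"
    and cstar_identity: "norm (star x * x) = norm x ^ 2"

instantiation complex :: cstar_algebra
begin
definition scaleC_complex :: "complex \<Rightarrow> complex \<Rightarrow> complex" where "scaleC_complex = (*)"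
definition star_complex :: "complex \<Rightarrow> complex" where "star_complex = cnj"
instance
  by standard
    (simp_all add: scaleC_complex_def star_complex_def algebra_simps norm_mult power2_eq_square
      scaleR_conv_of_real)
end

global_interpretation complex_vector: vector_space "scaleC :: complex \<Rightarrow> 'a \<Rightarrow> 'a::cstar_algebra"
  defines csubspace = complex_vector.subspace
    and cspan = complex_vector.span
  by standard (simp_all add: scaleC_add_right scaleC_add_left scaleC_scaleC scaleC_one)

section \<open>The involutive quantale of closed subspaces\<close>

definition max_spectrum :: "'a::cstar_algebra set set" where
  "max_spectrum = {V. csubspace V \<and> closed V}"

definition mstar :: "'a::cstar_algebra set \<Rightarrow> 'a set" where
  "mstar V = star ` V"

definition mprod :: "'a::cstar_algebra set \<Rightarrow> 'a set \<Rightarrow> 'a set" (infixl "\<odot>" 70) where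
  "V \<odot> W = closure (cspan {a * b | a b. a \<in> V \<and> b \<in> W})"

text \<open>For subspaces, the span of the union is their (algebraic) sum.\<close>

definition mjoin :: "'a::cstar_algebra set set \<Rightarrow> 'a set" where
  "mjoin F = closure (cspan (\<Union>F))"

definition join_dense :: "'a::cstar_algebra set set \<Rightarrow> 'a set set \<Rightarrow> bool" where
  "join_dense S I \<longleftrightarrow> S \<subseteq> I \<and> (\<forall>V\<in>I. \<exists>F\<subseteq>S. V = mjoin F)"

section \<open>Subalgebras, normalizers and the pseudogroup\<close>

definition closed_star_subalgebra :: "'a::cstar_algebra set \<Rightarrow> bool" where
  "closed_star_subalgebra B \<longleftrightarrow>
     csubspace B \<and> closed B \<and> (\<forall>a\<in>B. \<forall>b\<in>B. a * b \<in> B) \<and> (\<forall>a\<in>B. star a \<in> B)"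

definition normalizer :: "'a::cstar_algebra set \<Rightarrow> 'a set" where
  "normalizer B = {n. (\<forall>b\<in>B. n * b * star n \<in> B) \<and> (\<forall>b\<in>B. star n * b * n \<in> B)}"

definition pseudogroup :: "'a::cstar_algebra set \<Rightarrow> 'a set set" where
  "pseudogroup B = {V \<in> max_spectrum.
     mstar V \<odot> V \<subseteq> B \<and> V \<odot> mstar V \<subseteq> B \<and> V \<odot> B \<subseteq> V \<and> B \<odot> V \<subseteq> V}"

text \<open>
  A net in \<open>B\<close> is represented by the filter on \<open>A\<close> generated by the images of its tails. No
  monotonicity, positivity or boundedness of the net is required, so approximate units in any
  stricter sense are covered.
\<close>

definition contains_approximate_unit :: "'a::cstar_algebra set \<Rightarrow> bool" where
  "contains_approximate_unit B \<longleftrightarrow>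
     (\<exists>F. F \<noteq> bot \<and> (\<forall>\<^sub>F u in F. u \<in> B) \<and>
       (\<forall>a. ((\<lambda>u. u * a) \<longlongrightarrow> a) F \<and> ((\<lambda>u. a * u) \<longlongrightarrow> a) F))"

section \<open>The map \<open>n \<mapsto> BnB\<close>\<close>

definition line :: "'a::cstar_algebra \<Rightarrow> 'a set" where
  "line n = cspan {n}"

definition sigma_map :: "'a::cstar_algebra set \<Rightarrow> 'a \<Rightarrow> 'a set" where
  "sigma_map B n = B \<odot> line n \<odot> B"

lemma line_eq: "line n = range (\<lambda>c. c *\<^sub>C n)"
  by (simp add: line_def complex_vector.span_singleton)


lemma bounded_linear_scaleC: "bounded_linear (\<lambda>x::'a::cstar_algebra. c *\<^sub>C x)"
  by (rule bounded_linear_intro[where K="cmod c"])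
    (simp_all add: scaleC_add_right scaleR_scaleC scaleC_scaleC norm_scaleC mult.commute)

lemma csubspace_closure:
  fixes V :: "'a::cstar_algebra set"
  assumes "csubspace V" shows "csubspace (closure V)"
proof -
  have V: "0 \<in> V" "\<And>x y. x \<in> V \<Longrightarrow> y \<in> V \<Longrightarrow> x + y \<in> V" "\<And>c x. x \<in> V \<Longrightarrow> c *\<^sub>C x \<in> V"
    using assms by (auto simp: complex_vector.subspace_def)
  have "x + y \<in> closure V" if "x \<in> closure V" "y \<in> closure V" for x y
  proof -
    from that(1) obtain f where f: "\<And>k. f k \<in> V" "f \<longlonglongrightarrow> x"
      unfolding closure_sequential by blast
    from that(2) obtain g where "\<And>k. g k \<in> V" "g \<longlonglongrightarrow> y"
      unfolding closure_sequential by blast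
    with f have "\<forall>k. f k + g k \<in> V" "(\<lambda>k. f k + g k) \<longlonglongrightarrow> x + y"
      by (simp_all add: V(2) tendsto_add)
    then show ?thesis
      unfolding closure_sequential by (intro exI[of _ "\<lambda>k. f k + g k"]) simp
  qed
  moreover have "c *\<^sub>C x \<in> closure V" if "x \<in> closure V" for c x
  proof -
    from that obtain f where "\<And>k. f k \<in> V" "f \<longlonglongrightarrow> x"
      unfolding closure_sequential by blast
    then have "\<forall>k. c *\<^sub>C f k \<in> V" "(\<lambda>k. c *\<^sub>C f k) \<longlonglongrightarrow> c *\<^sub>C x"
      by (simp_all add: V(3) bounded_linear.tendsto[OF bounded_linear_scaleC])
    then show ?thesis
      unfolding closure_sequential by (intro exI[of _ "\<lambda>k. c *\<^sub>C f k"]) simp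
  qed
  ultimately show ?thesis
    using V(1) closure_subset[of V] by (auto simp: complex_vector.subspace_def)
qed

lemma line_mprod:
  fixes B :: "'a::cstar_algebra set"
  assumes "csubspace B"
  shows "line n \<odot> B = closure ((\<lambda>b. n * b) ` B)"
proof -
  have B: "0 \<in> B" "\<And>x y. x \<in> B \<Longrightarrow> y \<in> B \<Longrightarrow> x + y \<in> B" "\<And>c x. x \<in> B \<Longrightarrow> c *\<^sub>C x \<in> B"
    using assms by (auto simp: complex_vector.subspace_def)
  have "{a * b |a b. a \<in> line n \<and> b \<in> B} = (\<lambda>b. n * b) ` B" (is "?L = ?R")
  proof
    show "?L \<subseteq> ?R"
      using B(3) by (auto simp: line_eq mult_scaleC_left simp flip: mult_scaleC_right)
    show "?R \<subseteq> ?L"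
      by (force simp: line_def intro: complex_vector.span_base)
  qed
  moreover have "csubspace ?R"
    unfolding complex_vector.subspace_def
  proof (intro conjI ballI allI)
    show "0 \<in> ?R" using B(1) by force
    show "x + y \<in> ?R" if "x \<in> ?R" "y \<in> ?R" for x y
      using that B(2) by (auto simp flip: distrib_left)
    show "c *\<^sub>C x \<in> ?R" if "x \<in> ?R" for c x
      using that B(3) by (auto simp flip: mult_scaleC_right)
  qed
  ultimately show ?thesis
    by (simp add: mprod_def complex_vector.span_eq_iff[THEN iffD2])
qed

lemma mprod_line:
  fixes B :: "'a::cstar_algebra set"
  assumes "csubspace B"
  shows "B \<odot> line n = closure ((\<lambda>b. b * n) ` B)"
proof -
  have B: "0 \<in> B" "\<And>x y. x \<in> B \<Longrightarrow> y \<in> B \<Longrightarrow> x + y \<in> B" "\<And>c x. x \<in> B \<Longrightarrow> c *\<^sub>C x \<in> B"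
    using assms by (auto simp: complex_vector.subspace_def)
  have "{a * b |a b. a \<in> B \<and> b \<in> line n} = (\<lambda>b. b * n) ` B" (is "?L = ?R")
  proof
    show "?L \<subseteq> ?R"
      using B(3) by (auto simp: line_eq mult_scaleC_right simp flip: mult_scaleC_left)
    show "?R \<subseteq> ?L"
      by (force simp: line_def intro: complex_vector.span_base)
  qed
  moreover have "csubspace ?R"
    unfolding complex_vector.subspace_def
  proof (intro conjI ballI allI)
    show "0 \<in> ?R" using B(1) by force
    show "x + y \<in> ?R" if "x \<in> ?R" "y \<in> ?R" for x y
      using that B(2) by (auto simp flip: distrib_right)
    show "c *\<^sub>C x \<in> ?R" if "x \<in> ?R" for c x
      using that B(3) by (auto simp flip: mult_scaleC_left)
  qed
  ultimately show ?thesis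
    by (simp add: mprod_def complex_vector.span_eq_iff[THEN iffD2])
qed

lemma sigma_map_eq:
  fixes B :: "'a::cstar_algebra set"
  assumes "csubspace B"
  shows "sigma_map B n = closure (cspan {b * n * b' | b b'. b \<in> B \<and> b' \<in> B})" (is "_ = closure ?S")
proof
  have *: "a * b' \<in> closure ?S" if "a \<in> closure ((\<lambda>b. b * n) ` B)" "b' \<in> B" for a b'
  proof -
    from that(1) obtain x where x: "\<And>k. x k \<in> (\<lambda>b. b * n) ` B" "x \<longlonglongrightarrow> a"
      unfolding closure_sequential by blast
    have "x k * b' \<in> ?S" for k
    proof -
      obtain b where "b \<in> B" "x k = b * n"
        using x(1)[of k] by blast
      with \<open>b' \<in> B\<close> have "x k * b' \<in> {b * n * b' | b b'. b \<in> B \<and> b' \<in> B}"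
        unfolding mem_Collect_eq by (intro exI[of _ b] exI[of _ b']) simp
      then show ?thesis
        by (rule complex_vector.span_base)
    qed
    moreover have "(\<lambda>k. x k * b') \<longlonglongrightarrow> a * b'"
      by (intro tendsto_mult x(2) tendsto_const)
    ultimately show ?thesis
      unfolding closure_sequential by (intro exI[of _ "\<lambda>k. x k * b'"]) simp
  qed
  have "cspan {a * b |a b. a \<in> B \<odot> line n \<and> b \<in> B} \<subseteq> closure ?S"
    by (rule complex_vector.span_minimal)
      (use * in \<open>auto simp: mprod_line[OF assms] intro!: csubspace_closure complex_vector.subspace_span\<close>)
  then show "sigma_map B n \<subseteq> closure ?S"
    unfolding sigma_map_def mprod_def[of "B \<odot> line n"] by (simp add: closure_minimal)
  have "{b * n * b' | b b'. b \<in> B \<and> b' \<in> B} \<subseteq> {a * b |a b. a \<in> B \<odot> line n \<and> b \<in> B}"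
    using closure_subset[of "(\<lambda>b. b * n) ` B"] by (auto simp: mprod_line[OF assms])
  then show "closure ?S \<subseteq> sigma_map B n"
    unfolding sigma_map_def mprod_def[of "B \<odot> line n"]
    by (intro closure_mono complex_vector.span_mono)
qed

lemma normalizer_mult:
  assumes "m \<in> normalizer B" "n \<in> normalizer B" shows "m * n \<in> normalizer B"
proof -
  have "m * n * b * star (m * n) = m * (n * b * star n) * star m"
    "star (m * n) * b * (m * n) = star n * (star m * b * m) * n" for b
    by (simp_all add: star_mult mult.assoc)
  with assms show ?thesis by (simp add: normalizer_def)
qed

lemma normalizer_star: "n \<in> normalizer B \<Longrightarrow> star n \<in> normalizer B"
  by (simp add: normalizer_def star_star)

end

theory Submission
  imports Defs
begin

text \<open>
  Everything rests on one factorisation: if \<open>x\<^sup>*x \<in> B\<close> then \<open>x\<close> is a limit of elements \<open>xe\<close>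
  with \<open>e \<in> B\<close> (\<open>in_closure_right_multiples\<close>). One would usually take for \<open>e\<close> functions of
  \<open>a = x\<^sup>*x\<close> that tend to 1 away from 0 and argue by continuous functional calculus. Here a single
  rational function suffices. Put \<open>b = a/(1 + a\<^sup>2)\<close>, which lies in \<open>B\<close> when \<open>\<parallel>a\<parallel> < 1\<close>, and let
  \<open>e = ab\<close>, so that \<open>1 - e = 1/(1 + a\<^sup>2)\<close>. Then \<open>\<parallel>x - xe\<parallel>\<^sup>2 = \<parallel>(1 - e)b\<parallel>\<close>, and the Cayley transform
  \<open>(1 - \<i>a)/(1 + \<i>a)\<close>, an isometry with real part \<open>1 - 2ab\<close> and imaginary part \<open>-2b\<close>, gives
  \<open>\<parallel>b\<parallel> \<le> 1/2\<close> and shows that multiplication by \<open>1 - e\<close> is a contraction. After rescaling \<open>x\<close>, each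
  step multiplies \<open>\<parallel>x\<parallel>\<^sup>2\<close> by at most \<open>2/3\<close>; the factorisation follows by iterating.

  Lax multiplicativity: for normalizers \<open>m\<close>, \<open>n\<close> and \<open>b, b' \<in> B\<close> one has
  \<open>(bm)\<^sup>*(bm) \<in> B\<close> and \<open>(nb')(nb')\<^sup>* \<in> B\<close>, so \<open>bm\<close> is a limit of elements \<open>bme\<close> and \<open>nb'\<close> of
  elements \<open>e'nb'\<close>, whence \<open>bmnb' \<in> \<sigma>(m)\<sigma>(n)\<close>.

  Join-density: every element \<open>v\<close> of a member \<open>V\<close> of the pseudogroup is a normalizer with
  \<open>v\<^sup>*v, vv\<^sup>* \<in> B\<close>, so the factorisation on both sides gives \<open>v \<in> \<sigma>(v) \<subseteq> V\<close>, and \<open>V\<close> is the join of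
  the \<open>\<sigma>(v)\<close>.

  Commutative \<open>B\<close>: the point is \<open>BnB \<subseteq> nB\<close>. For \<open>y = nb'\<close> both \<open>y\<^sup>*y\<close> and \<open>yy\<^sup>*\<close> lie in
  \<open>B\<close>, and the factorisation, applied to the closed ideal generated by \<open>y\<^sup>*y\<close>, writes \<open>y\<close> as a limit of
  elements \<open>yy\<^sup>*yg\<close> with \<open>g \<in> B\<close>. Since \<open>yy\<^sup>*\<close> commutes with \<open>b\<close>, we get
  \<open>b(yy\<^sup>*)yg = y(y\<^sup>*by)g \<in> nB\<close>. The equality \<open>BnB = Bn\<close> follows by taking adjoints, and then
  \<open>\<sigma>(m)\<sigma>(n)\<close> is generated by products of \<open>Bm\<close> with \<open>nB\<close>, which lie in \<open>BmnB\<close>.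
\<close>

section \<open>The involution and closed subspaces\<close>

lemma star_zero [simp]: "star (0::'a::cstar_algebra) = 0"
  by (metis add_cancel_right_left star_add)

lemma star_diff: "star (x - y :: 'a::cstar_algebra) = star x - star y"
  by (metis add_diff_cancel diff_add_cancel star_add)

lemma star_scaleR: "star (r *\<^sub>R x :: 'a::cstar_algebra) = r *\<^sub>R star x"
  by (simp add: scaleR_scaleC star_scaleC)

lemma norm_star [simp]: "norm (star x :: 'a::cstar_algebra) = norm x"
proof -
  have le: "norm y \<le> norm (star y)" for y :: 'a
  proof (cases "y = 0")
    case False
    have "norm y * norm y \<le> norm (star y) * norm y"
      using norm_mult_ineq[of "star y" y] by (simp add: cstar_identity power2_eq_square)
    with False show ?thesis by simp
  qed simp
  from le[of x] le[of "star x"] show ?thesis by (simp add: star_star)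
qed

lemma bounded_linear_star: "bounded_linear (star :: 'a::cstar_algebra \<Rightarrow> 'a)"
  by (rule bounded_linear_intro[where K=1]) (simp_all add: star_add star_scaleR)

lemmas continuous_on_star = bounded_linear.continuous_on[OF bounded_linear_star]

lemma csubspaceD:
  assumes "csubspace (V::'a::cstar_algebra set)"
  shows "0 \<in> V" "x \<in> V \<Longrightarrow> y \<in> V \<Longrightarrow> x + y \<in> V" "x \<in> V \<Longrightarrow> c *\<^sub>C x \<in> V"
    "x \<in> V \<Longrightarrow> y \<in> V \<Longrightarrow> x - y \<in> V" "x \<in> V \<Longrightarrow> r *\<^sub>R x \<in> V"
  using assms complex_vector.subspace_diff[of V x y]
  by (auto simp: complex_vector.subspace_def scaleR_scaleC)

lemma closed_star_subalgebraD:
  assumes "closed_star_subalgebra (B::'a::cstar_algebra set)"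
  shows "csubspace B" "closed B" "a \<in> B \<Longrightarrow> b \<in> B \<Longrightarrow> a * b \<in> B" "a \<in> B \<Longrightarrow> star a \<in> B"
  using assms by (auto simp: closed_star_subalgebra_def)

lemma closure_cspan_least:
  assumes "csubspace W" "closed W" "S \<subseteq> (W::'a::cstar_algebra set)"
  shows "closure (cspan S) \<subseteq> W"
  by (intro closure_minimal complex_vector.span_minimal assms)

lemma csubspace_closure_cspan: "csubspace (closure (cspan (S::'a::cstar_algebra set)))"
  by (intro csubspace_closure complex_vector.subspace_span)

lemma closure_cspan_superset: "S \<subseteq> closure (cspan (S::'a::cstar_algebra set))"
  using closure_subset complex_vector.span_superset by blast

text \<open>
  Multiplication is separately continuous and linear, so the inclusion passes from generators to the
  closed spans one factor at a time.
\<close>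

lemma mult_mem_of_generators:
  fixes W :: "'a::cstar_algebra set"
  assumes W: "csubspace W" "closed W"
    and gen: "\<And>s t. s \<in> S \<Longrightarrow> t \<in> T \<Longrightarrow> s * t \<in> W"
    and x: "x \<in> closure (cspan S)" and y: "y \<in> closure (cspan T)"
  shows "x * y \<in> W"
proof -
  have *: "x * t \<in> W" if "t \<in> T" for t
  proof -
    have "closure (cspan S) \<subseteq> (\<lambda>z. z * t) -` W"
    proof (rule closure_cspan_least)
      show "csubspace ((\<lambda>z. z * t) -` W)"
        using csubspaceD[OF W(1)]
        by (auto simp: complex_vector.subspace_def distrib_right mult_scaleC_left)
      show "closed ((\<lambda>z. z * t) -` W)"
        by (intro closed_vimage W continuous_intros)
    qed (use gen that in auto)
    with x show ?thesis by auto
  qed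
  have "closure (cspan T) \<subseteq> (\<lambda>z. x * z) -` W"
  proof (rule closure_cspan_least)
    show "csubspace ((\<lambda>z. x * z) -` W)"
      using csubspaceD[OF W(1)]
      by (auto simp: complex_vector.subspace_def distrib_left mult_scaleC_right)
    show "closed ((\<lambda>z. x * z) -` W)"
      by (intro closed_vimage W continuous_intros)
  qed (use * in auto)
  with y show ?thesis by auto
qed

lemma mprod_least:
  fixes W :: "'a::cstar_algebra set"
  assumes "csubspace W" "closed W" "\<And>a b. a \<in> V \<Longrightarrow> b \<in> U \<Longrightarrow> a * b \<in> W"
  shows "V \<odot> U \<subseteq> W"
  unfolding mprod_def by (rule closure_cspan_least) (use assms in auto)

lemma mult_in_mprod: "a \<in> V \<Longrightarrow> b \<in> U \<Longrightarrow> a * b \<in> V \<odot> (U::'a::cstar_algebra set)"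
  unfolding mprod_def by (rule subsetD[OF closure_cspan_superset]) blast

lemma mstar_closure_cspan:
  fixes S :: "'a::cstar_algebra set"
  shows "mstar (closure (cspan S)) = closure (cspan (star ` S))"
proof -
  have *: "mstar (closure (cspan R)) \<subseteq> closure (cspan (star ` R))" for R :: "'a set"
  proof -
    have "closure (cspan R) \<subseteq> star -` closure (cspan (star ` R))"
    proof (rule closure_cspan_least)
      show "csubspace (star -` closure (cspan (star ` R)))"
        using csubspaceD[OF csubspace_closure_cspan[of "star ` R"]]
        by (auto simp: complex_vector.subspace_def star_add star_scaleC)
      show "closed (star -` closure (cspan (star ` R)))"
        by (rule closed_vimage[OF closed_closure continuous_on_star[OF continuous_on_id]])
    qed (use closure_cspan_superset[of "star ` R"] in auto)
    then show ?thesis by (auto simp: mstar_def)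
  qed
  have "star ` star ` T = T" for T :: "'a set"
    by (simp add: image_image star_star)
  then have "mstar (closure (cspan (star ` S))) \<subseteq> closure (cspan S)"
    using *[of "star ` S"] by simp
  then have "mstar (mstar (closure (cspan (star ` S)))) \<subseteq> mstar (closure (cspan S))"
    unfolding mstar_def by (rule image_mono)
  then have "closure (cspan (star ` S)) \<subseteq> mstar (closure (cspan S))"
    by (simp add: mstar_def image_image star_star)
  with *[of S] show ?thesis by (rule subset_antisym)
qed

lemma mstar_mprod:
  fixes V W :: "'a::cstar_algebra set"
  shows "mstar (V \<odot> W) = mstar W \<odot> mstar V"
proof -
  have "star ` {a * b |a b. a \<in> V \<and> b \<in> W} = {a * b |a b. a \<in> star ` W \<and> b \<in> star ` V}"
  proof (intro subset_antisym subsetI)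
    fix x assume "x \<in> {a * b |a b. a \<in> star ` W \<and> b \<in> star ` V}"
    then obtain a b where "a \<in> V" "b \<in> W" "x = star (a * b)"
      by (auto simp: star_mult)
    then show "x \<in> star ` {a * b |a b. a \<in> V \<and> b \<in> W}" by blast
  next
    fix x assume "x \<in> star ` {a * b |a b. a \<in> V \<and> b \<in> W}"
    then obtain a b where "a \<in> V" "b \<in> W" "x = star b * star a"
      by (auto simp: star_mult)
    then show "x \<in> {a * b |a b. a \<in> star ` W \<and> b \<in> star ` V}" by blast
  qed
  then show ?thesis by (simp only: mprod_def mstar_closure_cspan) (simp only: mstar_def)
qed

lemma mstar_line: "mstar (line n) = line (star (n::'a::cstar_algebra))"
proof -
  have "star ` range (\<lambda>c. c *\<^sub>C n) = range (\<lambda>c. cnj c *\<^sub>C star n)"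
    by (simp add: image_image star_scaleC)
  also have "\<dots> = (\<lambda>c. c *\<^sub>C star n) ` range cnj"
    by (simp add: image_image)
  also have "range cnj = UNIV"
    by (metis complex_cnj_cnj surjI)
  finally show ?thesis by (simp add: mstar_def line_eq)
qed

section \<open>Factorisation through the coefficient algebra\<close>

text \<open>
  The equation for \<open>b\<close> says \<open>b = a/(1 + a\<^sup>2)\<close>, so for \<open>c = \<i>\<close> the left-hand side is the norm of
  \<open>uz\<close> for the Cayley transform \<open>u = (1 - \<i>a)/(1 + \<i>a) = (1 - 2ab) - 2\<i>b\<close>, and for \<open>c = -\<i>\<close> that of
  \<open>u\<^sup>*z\<close>. As \<open>A\<close> may lack a unit, unitarity is expressed through the action on \<open>A\<close>: it amounts to
  \<open>(1 - 2ab)\<^sup>2 + 4b\<^sup>2 = 1\<close>, which gives \<open>(uz)\<^sup>*(uz) = z\<^sup>*z\<close>.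
\<close>

lemma Cayley_isometry:
  fixes a b z :: "'a::cstar_algebra"
  assumes sa: "star a = a" and sb: "star b = b" and comm: "a * b = b * a"
    and b: "b = a - a * a * b" and c: "c = \<i> \<or> c = - \<i>"
  shows "norm (z - 2 *\<^sub>R (a * b * z) - c *\<^sub>C (2 *\<^sub>R (b * z))) = norm z"
proof -
  define p where "p = z - 2 *\<^sub>R (a * b * z)"
  define q where "q = 2 *\<^sub>R (b * z)"
  \<comment> \<open>the defining equation of \<open>b\<close> in the form \<open>a\<^sup>2b = a - b\<close>\<close>
  have abb: "a * (a * (b * t)) = a * t - b * t" for t
    using arg_cong[OF b, of "\<lambda>s. s * t"] by (simp add: left_diff_distrib mult.assoc algebra_simps)
  have cc: "b * (a * t) = a * (b * t)" for t
    using comm by (metis mult.assoc)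
  have sc: "cnj c * c = 1" "cnj c = - c" using c by auto
  have sp: "star p = star z - 2 *\<^sub>R (star z * (a * b))"
    using comm by (simp add: p_def star_diff star_scaleR star_mult sa sb mult.assoc)
  have sq: "star q = 2 *\<^sub>R (star z * b)"
    by (simp add: q_def star_scaleR star_mult sb)
  have pq: "star p * q = star q * p"
    unfolding sp sq unfolding p_def q_def
    by (simp add: algebra_simps cc)
  have "star (p - c *\<^sub>C q) * (p - c *\<^sub>C q)
      = star p * p - c *\<^sub>C (star p * q) - cnj c *\<^sub>C (star q * p) + (cnj c * c) *\<^sub>C (star q * q)"
    by (simp add: star_diff star_scaleC algebra_simps mult_scaleC_left mult_scaleC_right scaleC_scaleC)
  also have "\<dots> = star p * p + star q * q"
    using sc pq by (simp add: scaleC_one complex_vector.scale_minus_left)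
  also have "\<dots> = star z * z"
    unfolding sp sq unfolding p_def q_def
    by (simp add: algebra_simps cc abb flip: scaleR_add_left)
  finally have "norm (p - c *\<^sub>C q) ^ 2 = norm z ^ 2"
    by (metis cstar_identity)
  then show ?thesis by (simp add: p_def q_def)
qed

text \<open>
  With \<open>u\<close> the Cayley transform, \<open>-2\<i>b\<close> is half of \<open>u - u\<^sup>*\<close> and \<open>1 - ab\<close> is a quarter of
  \<open>2 + u + u\<^sup>*\<close>, so both bounds are triangle inequalities. They replace the spectral estimates
  \<open>\<bar>t/(1 + t\<^sup>2)\<bar> \<le> 1/2\<close> and \<open>1/(1 + t\<^sup>2) \<le> 1\<close>.
\<close>

lemma resolvent_contractions:
  fixes a b z :: "'a::cstar_algebra"
  assumes "star a = a" "star b = b" "a * b = b * a" "b = a - a * a * b"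
  shows "2 * norm (b * z) \<le> norm z" "norm (z - a * b * z) \<le> norm z"
proof -
  define p where "p = z - 2 *\<^sub>R (a * b * z)"
  define q where "q = 2 *\<^sub>R (b * z)"
  have u: "norm (p - \<i> *\<^sub>C q) = norm z" "norm (p + \<i> *\<^sub>C q) = norm z"
    using Cayley_isometry[OF assms, of \<i> z] Cayley_isometry[OF assms, of "-\<i>" z]
    by (simp_all add: p_def q_def complex_vector.scale_minus_left)
  have "norm ((p + \<i> *\<^sub>C q) - (p - \<i> *\<^sub>C q)) \<le> norm z + norm z"
    using norm_triangle_ineq4[of "p + \<i> *\<^sub>C q" "p - \<i> *\<^sub>C q"] u by simp
  also have "(p + \<i> *\<^sub>C q) - (p - \<i> *\<^sub>C q) = 2 *\<^sub>R (\<i> *\<^sub>C q)"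
    by (simp add: scaleR_2)
  finally show "2 * norm (b * z) \<le> norm z"
    by (simp add: norm_scaleC q_def)
  have "z - a * b * z = (1/4) *\<^sub>R (2 *\<^sub>R z + ((p + \<i> *\<^sub>C q) + (p - \<i> *\<^sub>C q)))"
    by (simp add: p_def algebra_simps flip: scaleR_add_left)
  also have "norm \<dots> \<le> (1/4) * (2 * norm z + (norm z + norm z))"
    using norm_triangle_ineq[of "2 *\<^sub>R z" "(p + \<i> *\<^sub>C q) + (p - \<i> *\<^sub>C q)"]
      norm_triangle_ineq[of "p + \<i> *\<^sub>C q" "p - \<i> *\<^sub>C q"] u
    by simp
  finally show "norm (z - a * b * z) \<le> norm z" by simp
qed

text \<open>
  The element \<open>a/(1 + a\<^sup>2)\<close> is the fixed point of \<open>b \<mapsto> a - a\<^sup>2b\<close>. Running the contraction principle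
  inside the self-adjoint elements of \<open>B\<close> that commute with \<open>a\<close> yields all the required
  properties of the fixed point at once.
\<close>

lemma exists_resolvent:
  fixes B :: "'a::cstar_algebra set"
  assumes B: "closed_star_subalgebra B" and a: "a \<in> B" "star a = a" "norm a < 1"
  obtains b where "b \<in> B" "star b = b" "a * b = b * a" "b = a - a * a * b"
proof -
  note BD = closed_star_subalgebraD[OF B] csubspaceD[OF closed_star_subalgebraD(1)[OF B]]
  define K where "K = {b \<in> B. star b = b \<and> a * b = b * a}"
  have "K = B \<inter> {b. star b = b} \<inter> {b. a * b = b * a}" by (auto simp: K_def)
  moreover have "closed {b::'a. star b = b}" "closed {b. a * b = b * a}"
    by (intro closed_Collect_eq continuous_on_star continuous_intros)+
  ultimately have K1: "complete K"
    using BD(2) by (simp only: complete_eq_closed closed_Int)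
  have "0 \<in> K" using BD(5) by (simp add: K_def)
  then have K2: "K \<noteq> {}" by blast
  have K3: "(\<lambda>b. a - a * a * b) ` K \<subseteq> K"
  proof (clarsimp simp: K_def, intro conjI)
    fix b assume b: "b \<in> B" "star b = b" "a * b = b * a"
    then show "a - a * a * b \<in> B" using BD a by simp
    have "b * a * a = a * a * b" using b(3) by (metis mult.assoc)
    then show "star (a - a * a * b) = a - a * a * b"
      using b a by (simp add: star_diff star_mult mult.assoc)
    show "a * (a - a * a * b) = (a - a * a * b) * a"
      using b(3) by (simp add: right_diff_distrib left_diff_distrib) (metis mult.assoc)
  qed
  have lip: "dist (a - a * a * x) (a - a * a * y) \<le> norm a * norm a * dist x y" for x y
  proof -
    have "dist (a - a * a * x) (a - a * a * y) = norm (a * a * (y - x))"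
      by (simp add: dist_norm algebra_simps)
    also have "\<dots> \<le> norm a * norm a * norm (y - x)"
      by (meson norm_mult_ineq mult_right_mono norm_ge_zero order_trans)
    finally show ?thesis by (simp add: dist_norm norm_minus_commute)
  qed
  have "norm a * norm a < 1"
    using mult_strict_mono[OF a(3) a(3)] by simp
  then have "\<exists>!b\<in>K. a - a * a * b = b"
    by (intro Banach_fix[OF K1 K2 _ _ K3 lip]) simp_all
  then obtain b where "b \<in> B" "star b = b" "a * b = b * a" "a - a * a * b = b"
    unfolding K_def by blast
  then show ?thesis using that[of b] by simp
qed

text \<open>
  Take \<open>e = ab\<close> with \<open>a = x\<^sup>*x\<close> and \<open>b = a/(1 + a\<^sup>2)\<close>. Then
  \<open>(x - xe)\<^sup>*(x - xe) = (1 - ab)a(1 - ab) = (1 - ab)b\<close>, of norm at most \<open>\<parallel>b\<parallel> \<le> 1/2\<close>.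
\<close>

lemma approximate_right_unit_step:
  fixes B :: "'a::cstar_algebra set"
  assumes B: "closed_star_subalgebra B" and x: "star x * x \<in> B" "norm x ^ 2 < 1"
  obtains e where "e \<in> B" "norm (x - x * e) ^ 2 \<le> 1/2"
proof -
  define a where "a = star x * x"
  have a: "a \<in> B" "star a = a" "norm a < 1"
    using x by (simp_all add: a_def star_mult star_star cstar_identity)
  obtain b where b: "b \<in> B" "star b = b" "a * b = b * a" "b = a - a * a * b"
    using exists_resolvent[OF B a] .
  note contr = resolvent_contractions[OF a(2) b(2-4)]
  have ab: "star (a * b) = a * b" using a b by (simp add: star_mult)
  have "star (x - x * (a * b)) * (x - x * (a * b)) = (a - a * a * b) - a * b * (a - a * a * b)"
    unfolding star_diff star_mult[of x] ab by (simp add: algebra_simps a_def)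
  also have "\<dots> = b - a * b * b" using b(4) by simp
  finally have "norm (x - x * (a * b)) ^ 2 = norm (b - a * b * b)"
    by (metis cstar_identity)
  also have "\<dots> \<le> norm b" by (rule contr)
  also have "norm b \<le> 1/2"
  proof (cases "b = 0")
    case False
    have "2 * norm (b * b) \<le> norm b" by (rule contr)
    also have "norm (b * b) = norm b * norm b"
      using cstar_identity[of b] b(2) by (simp add: power2_eq_square)
    finally show ?thesis using False by simp
  qed simp
  finally show ?thesis
    using that[of "a * b"] closed_star_subalgebraD(3)[OF B] a b by simp
qed

text \<open>
  Iterating the previous step works because \<open>y = x - xe\<close> again satisfies \<open>y\<^sup>*y \<in> B\<close>, and
  \<open>y - yf = x - x(e + f - ef)\<close>.
\<close>

lemma approximate_right_unit:
  fixes B :: "'a::cstar_algebra set"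
  assumes B: "closed_star_subalgebra B"
  shows "star x * x \<in> B \<Longrightarrow> \<exists>e\<in>B. norm (x - x * e) ^ 2 \<le> (2/3) ^ k * norm x ^ 2"
proof (induction k arbitrary: x)
  case 0
  show ?case
    using csubspaceD(1)[OF closed_star_subalgebraD(1)[OF B]] by (intro bexI[of _ 0]) simp_all
next
  case (Suc k)
  note BD = closed_star_subalgebraD[OF B] csubspaceD[OF closed_star_subalgebraD(1)[OF B]]
  have "\<exists>e\<in>B. norm (x - x * e) ^ 2 \<le> 2/3 * norm x ^ 2"
  proof (cases "x = 0")
    case True
    then show ?thesis using BD(5) by auto
  next
    case False
    \<comment> \<open>Rescaling to squared norm \<open>3/4\<close>, below 1 but above the bound \<open>1/2\<close> of the step,
      makes the step a reduction by the factor \<open>(1/2)/(3/4) = 2/3\<close>.\<close>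
    define r where "r = sqrt (3/4) / norm x"
    have r: "r > 0" "r\<^sup>2 * norm x ^ 2 = 3/4"
      using False by (simp_all add: r_def power_divide)
    have "star (r *\<^sub>R x) * (r *\<^sub>R x) \<in> B" 
      using Suc.prems BD(9) by (simp add: star_scaleR)
    moreover have "norm (r *\<^sub>R x) ^ 2 < 1"
      using r by (simp add: power_mult_distrib)
    ultimately obtain e where e: "e \<in> B" "norm (r *\<^sub>R x - r *\<^sub>R x * e) ^ 2 \<le> 1/2"
      by (rule approximate_right_unit_step[OF B])
    have "r *\<^sub>R x - r *\<^sub>R x * e = r *\<^sub>R (x - x * e)"
      by (simp add: algebra_simps)
    with e(2) have "r\<^sup>2 * norm (x - x * e) ^ 2 \<le> 1/2"
      by (simp add: power_mult_distrib)
    also have "1/2 = r\<^sup>2 * (2/3 * norm x ^ 2)" using r(2) by simp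
    finally have "norm (x - x * e) ^ 2 \<le> 2/3 * norm x ^ 2" using r(1) by simp
    with e(1) show ?thesis by blast
  qed
  then obtain e where e: "e \<in> B" "norm (x - x * e) ^ 2 \<le> 2/3 * norm x ^ 2" by blast
  define h where "h = star x * x"
  have "star (x - x * e) * (x - x * e) = h - star e * h - h * e + star e * h * e"
    by (simp add: star_diff star_mult h_def algebra_simps)
  also have "\<dots> \<in> B" using Suc.prems e(1) BD by (simp add: h_def)
  finally obtain f where f: "f \<in> B"
      "norm ((x - x * e) - (x - x * e) * f) ^ 2 \<le> (2/3) ^ k * norm (x - x * e) ^ 2"
    using Suc.IH by blast
  have eq: "(x - x * e) - (x - x * e) * f = x - x * (e + f - e * f)"
    by (simp add: algebra_simps)
  have "(2/3) ^ k * norm (x - x * e) ^ 2 \<le> (2/3) ^ Suc k * norm x ^ 2"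
    using mult_left_mono[OF e(2), of "(2/3) ^ k"] by simp
  with f(2) have "norm (x - x * (e + f - e * f)) ^ 2 \<le> (2/3) ^ Suc k * norm x ^ 2"
    unfolding eq by (rule order_trans)
  moreover have "e + f - e * f \<in> B" using e(1) f(1) BD by simp
  ultimately show ?case by blast
qed

proposition in_closure_right_multiples:
  fixes B :: "'a::cstar_algebra set"
  assumes B: "closed_star_subalgebra B" and x: "star x * x \<in> B"
  shows "x \<in> closure ((\<lambda>b. x * b) ` B)"
proof -
  have "\<forall>k. \<exists>e\<in>B. norm (x - x * e) ^ 2 \<le> (2/3) ^ k * norm x ^ 2"
    using approximate_right_unit[OF B x] by blast
  then obtain e where e: "\<And>k. e k \<in> B" "\<And>k. norm (x - x * e k) ^ 2 \<le> (2/3) ^ k * norm x ^ 2"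
    by metis
  have "(\<lambda>k. norm (x - x * e k) ^ 2) \<longlonglongrightarrow> 0"
  proof (rule Lim_null_comparison)
    show "\<forall>\<^sub>F k in sequentially. norm (norm (x - x * e k) ^ 2) \<le> (2/3) ^ k * norm x ^ 2"
      using e(2) by simp
    show "(\<lambda>k. (2/3) ^ k * norm x ^ 2) \<longlonglongrightarrow> 0"
      by (intro tendsto_mult_left_zero LIMSEQ_realpow_zero) auto
  qed
  then have "(\<lambda>k. norm (x - x * e k)) \<longlonglongrightarrow> 0"
    using tendsto_real_sqrt[of "\<lambda>k. norm (x - x * e k) ^ 2" 0] by simp
  then have "(\<lambda>k. x * e k) \<longlonglongrightarrow> x"
    by (simp add: tendsto_iff dist_norm norm_minus_commute[of _ x])
  then show ?thesis
    unfolding closure_sequential using e(1) by (intro exI[of _ "\<lambda>k. x * e k"]) simp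
qed

lemma in_closure_left_multiples:
  fixes B :: "'a::cstar_algebra set"
  assumes B: "closed_star_subalgebra B" and x: "x * star x \<in> B"
  shows "x \<in> closure ((\<lambda>b. b * x) ` B)"
proof -
  have "star x \<in> closure ((\<lambda>b. star x * b) ` B)"
    using in_closure_right_multiples[OF B, of "star x"] x by (simp add: star_star)
  then have "star (star x) \<in> closure (star ` (\<lambda>b. star x * b) ` B)"
    using image_closure_subset[OF continuous_on_star[OF continuous_on_id]
        closed_closure closure_subset] by blast
  moreover have "star ` (\<lambda>b. star x * b) ` B \<subseteq> (\<lambda>b. b * x) ` B"
    using closed_star_subalgebraD(4)[OF B] by (auto simp: star_mult star_star)
  ultimately show ?thesis
    unfolding star_star by (rule subsetD[OF closure_mono, rotated])
qed

lemma closure_mult_closed: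
  fixes W :: "'a::cstar_algebra set"
  assumes "closed W" "x \<in> closure S" "y \<in> closure T" "\<And>s t. s \<in> S \<Longrightarrow> t \<in> T \<Longrightarrow> s * t \<in> W"
  shows "x * y \<in> W"
proof -
  from assms(2,3) obtain f g where f: "\<And>k. f k \<in> S" "f \<longlonglongrightarrow> x" and g: "\<And>k. g k \<in> T" "g \<longlonglongrightarrow> y"
    unfolding closure_sequential by blast
  have "(\<lambda>k. f k * g k) \<longlonglongrightarrow> x * y" by (intro tendsto_mult f g)
  then show ?thesis
    by (rule closed_sequentially[OF assms(1), rotated]) (intro assms(4) f g)
qed

section \<open>The map \<open>n \<mapsto> BnB\<close>\<close>

context
  fixes B :: "'a::cstar_algebra set"
  assumes B: "closed_star_subalgebra B"
begin

lemmas BD = closed_star_subalgebraD[OF B] csubspaceD[OF closed_star_subalgebraD(1)[OF B]]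
lemmas sigma_eq = sigma_map_eq[OF BD(1)]

lemma mstar_subalgebra: "mstar B = B"
  unfolding mstar_def
proof (intro subset_antisym subsetI)
  fix b assume "b \<in> B"
  then show "b \<in> star ` B"
    by (intro image_eqI[of _ star "star b"]) (simp_all add: star_star BD)
qed (use BD(4) in auto)

lemma normalizerD:
  assumes "n \<in> normalizer B" "b \<in> B"
  shows "n * b * star n \<in> B" "star n * b * n \<in> B"
    "n * (b * star n) \<in> B" "star n * (b * n) \<in> B"
  using assms unfolding normalizer_def mult.assoc by blast+

lemma csubspace_sigma: "csubspace (sigma_map B n)" and closed_sigma: "closed (sigma_map B n)"
  unfolding sigma_eq by (simp_all add: csubspace_closure_cspan)

lemma mult_in_sigma: "b \<in> B \<Longrightarrow> b' \<in> B \<Longrightarrow> b * n * b' \<in> sigma_map B n"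
  unfolding sigma_eq by (rule subsetD[OF closure_cspan_superset]) blast

lemma sigma_least:
  assumes "csubspace W" "closed W" "\<And>b b'. b \<in> B \<Longrightarrow> b' \<in> B \<Longrightarrow> b * n * b' \<in> W"
  shows "sigma_map B n \<subseteq> W"
  unfolding sigma_eq using assms by (intro closure_cspan_least) auto

lemma sigma_star: "sigma_map B (star n) = mstar (sigma_map B n)"
proof -
  have "star ` {b * n * b' |b b'. b \<in> B \<and> b' \<in> B} = {b * star n * b' |b b'. b \<in> B \<and> b' \<in> B}"
  proof (intro subset_antisym subsetI)
    fix x assume "x \<in> {b * star n * b' |b b'. b \<in> B \<and> b' \<in> B}"
    then obtain b b' where "b \<in> B" "b' \<in> B" "x = star (star b' * n * star b)"
      by (auto simp: star_mult star_star mult.assoc)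
    then show "x \<in> star ` {b * n * b' |b b'. b \<in> B \<and> b' \<in> B}"
      using BD(4) by blast
  next
    fix x assume "x \<in> star ` {b * n * b' |b b'. b \<in> B \<and> b' \<in> B}"
    then obtain b b' where "b \<in> B" "b' \<in> B" "x = star b' * star n * star b"
      by (auto simp: star_mult mult.assoc)
    then show "x \<in> {b * star n * b' |b b'. b \<in> B \<and> b' \<in> B}"
      using BD(4) by blast
  qed
  then show ?thesis by (simp add: sigma_eq mstar_closure_cspan)
qed

text \<open>
  A product of generators \<open>bnc\<close> and \<open>b'n\<^sup>*c'\<close> has the middle factor \<open>n(cb')n\<^sup>*\<close>, which is in \<open>B\<close>
  because \<open>n\<close> is a normalizer.
\<close>

lemma sigma_mult_star_self:
  assumes n: "n \<in> normalizer B"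
  shows "sigma_map B n \<odot> mstar (sigma_map B n) \<subseteq> B"
proof (rule mprod_least[OF BD(1,2)])
  fix v w assume "v \<in> sigma_map B n" "w \<in> mstar (sigma_map B n)"
  then have "v \<in> sigma_map B n" "w \<in> sigma_map B (star n)"
    by (simp_all add: sigma_star)
  then show "v * w \<in> B"
    unfolding sigma_eq
  proof (rule mult_mem_of_generators[OF BD(1,2), rotated], clarify)
    fix b c b' c' assume "b \<in> B" "c \<in> B" "b' \<in> B" "c' \<in> B"
    then have "b * (n * (c * b') * star n) * c' \<in> B"
      using n by (intro BD(3) normalizerD)
    then show "b * n * c * (b' * star n * c') \<in> B" by (simp add: mult.assoc)
  qed
qed

lemma sigma_in_pseudogroup:
  assumes n: "n \<in> normalizer B"
  shows "sigma_map B n \<in> pseudogroup B"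
  unfolding pseudogroup_def max_spectrum_def
proof (intro CollectI conjI csubspace_sigma closed_sigma)
  show "sigma_map B n \<odot> mstar (sigma_map B n) \<subseteq> B"
    by (rule sigma_mult_star_self[OF n])
  show "mstar (sigma_map B n) \<odot> sigma_map B n \<subseteq> B"
    using sigma_mult_star_self[OF normalizer_star[OF n]]
    by (simp add: sigma_star[symmetric] star_star)
  have B_span: "closure (cspan B) = B"
    using BD(1,2) by (simp add: complex_vector.span_eq_iff[THEN iffD2])
  show "sigma_map B n \<odot> B \<subseteq> sigma_map B n"
  proof (rule mprod_least[OF csubspace_sigma closed_sigma])
    fix v w assume "v \<in> sigma_map B n" "w \<in> B"
    then have "v \<in> closure (cspan {b * n * b' |b b'. b \<in> B \<and> b' \<in> B})" "w \<in> closure (cspan B)"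
      by (simp_all add: sigma_eq B_span)
    then show "v * w \<in> sigma_map B n"
    proof (rule mult_mem_of_generators[OF csubspace_sigma closed_sigma, rotated], clarify)
      fix c b b' assume "b \<in> B" "b' \<in> B" "c \<in> B"
      then show "b * n * b' * c \<in> sigma_map B n"
        using mult_in_sigma[of b "b' * c"] BD(3) by (simp add: mult.assoc)
    qed
  qed
  show "B \<odot> sigma_map B n \<subseteq> sigma_map B n"
  proof (rule mprod_least[OF csubspace_sigma closed_sigma])
    fix v w assume "w \<in> sigma_map B n" "v \<in> B"
    then have "v \<in> closure (cspan B)" "w \<in> closure (cspan {b * n * b' |b b'. b \<in> B \<and> b' \<in> B})"
      by (simp_all add: sigma_eq B_span)
    then show "v * w \<in> sigma_map B n"
    proof (rule mult_mem_of_generators[OF csubspace_sigma closed_sigma, rotated], clarify)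
      fix c b b' assume "b \<in> B" "b' \<in> B" "c \<in> B"
      then show "c * (b * n * b') \<in> sigma_map B n"
        using mult_in_sigma[of "c * b" b'] BD(3) by (simp add: mult.assoc)
    qed
  qed
qed

lemma left_mult_normalizer_factors:
  assumes n: "n \<in> normalizer B" and b: "b \<in> B"
  shows "b * n \<in> closure ((\<lambda>c. b * n * c) ` B)"
proof (rule in_closure_right_multiples[OF B])
  have "star n * (star b * b) * n \<in> B" using n b BD by (intro normalizerD) simp_all
  then show "star (b * n) * (b * n) \<in> B" by (simp add: star_mult mult.assoc)
qed

lemma right_mult_normalizer_factors:
  assumes n: "n \<in> normalizer B" and b: "b \<in> B"
  shows "n * b \<in> closure ((\<lambda>c. c * (n * b)) ` B)"
proof (rule in_closure_left_multiples[OF B])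
  have "n * (b * star b) * star n \<in> B" using n b BD by (intro normalizerD) simp_all
  then show "n * b * star (n * b) \<in> B" by (simp add: star_mult mult.assoc)
qed

text \<open>
  The two factorisations insert elements of \<open>B\<close> between \<open>m\<close> and \<open>n\<close>, turning \<open>bmnb'\<close> into a limit of
  products \<open>(bmc)(c'nb')\<close>.
\<close>

lemma sigma_mult_subset:
  assumes m: "m \<in> normalizer B" and n: "n \<in> normalizer B"
  shows "sigma_map B (m * n) \<subseteq> sigma_map B m \<odot> sigma_map B n"
proof (rule sigma_least)
  show "csubspace (sigma_map B m \<odot> sigma_map B n)" "closed (sigma_map B m \<odot> sigma_map B n)"
    by (simp_all add: mprod_def csubspace_closure_cspan)
  fix b b' assume b: "b \<in> B" "b' \<in> B"
  have "b * m * (n * b') \<in> sigma_map B m \<odot> sigma_map B n"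
  proof (rule closure_mult_closed[OF _ left_mult_normalizer_factors[OF m b(1)]
        right_mult_normalizer_factors[OF n b(2)]])
    show "closed (sigma_map B m \<odot> sigma_map B n)" by (simp add: mprod_def)
    fix s t assume "s \<in> (\<lambda>c. b * m * c) ` B" "t \<in> (\<lambda>c. c * (n * b')) ` B"
    then obtain c c' where c: "c \<in> B" "c' \<in> B" "s = b * m * c" "t = c' * n * b'"
      by (auto simp: mult.assoc)
    then show "s * t \<in> sigma_map B m \<odot> sigma_map B n"
      using b by (auto intro: mult_in_mprod mult_in_sigma)
  qed
  then show "b * (m * n) * b' \<in> sigma_map B m \<odot> sigma_map B n" by (simp add: mult.assoc)
qed

text \<open>
  The factorisation on the right puts \<open>bv\<close> in the closure of \<open>bvB\<close>, and the one on the left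
  puts \<open>v\<close> in the closure of \<open>Bv\<close>.
\<close>

lemma self_in_sigma:
  assumes "star v * v \<in> B" "v * star v \<in> B"
  shows "v \<in> sigma_map B v"
proof -
  have "b * v \<in> sigma_map B v" if "b \<in> B" for b
    using closure_mult_closed[OF closed_sigma _ in_closure_right_multiples[OF B assms(1)], of b "{b}"]
      mult_in_sigma that by (fastforce simp: mult.assoc)
  then have "closure ((\<lambda>b. b * v) ` B) \<subseteq> sigma_map B v"
    by (intro closure_minimal closed_sigma) auto
  then show ?thesis using in_closure_left_multiples[OF B assms(2)] by blast
qed

text \<open>
  Each \<open>v \<in> V\<close> satisfies \<open>v \<in> \<sigma>(v)\<close>, while \<open>\<sigma>(v) \<subseteq> BVB \<subseteq> V\<close>.
\<close>

lemma pseudogroup_join_of_sigma: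
  assumes V: "V \<in> pseudogroup B"
  shows "V \<subseteq> normalizer B" "V = mjoin (sigma_map B ` V)"
proof -
  have V1: "csubspace V" "closed V"
    and sub: "mstar V \<odot> V \<subseteq> B" "V \<odot> mstar V \<subseteq> B" "V \<odot> B \<subseteq> V" "B \<odot> V \<subseteq> V"
    using V by (simp_all add: pseudogroup_def max_spectrum_def)
  have VB: "v * b \<in> V" if "v \<in> V" "b \<in> B" for v b
    by (rule subsetD[OF sub(3) mult_in_mprod[OF that]])
  have BV: "b * v \<in> V" if "b \<in> B" "v \<in> V" for b v
    by (rule subsetD[OF sub(4) mult_in_mprod[OF that]])
  have star_V: "star v \<in> mstar V" if "v \<in> V" for v
    using that by (simp add: mstar_def)
  have VV: "v * star w \<in> B" "star v * w \<in> B" if "v \<in> V" "w \<in> V" for v w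
    using sub mult_in_mprod[OF that(1) star_V[OF that(2)]] mult_in_mprod[OF star_V[OF that(1)] that(2)]
    by auto
  show "V \<subseteq> normalizer B"
    unfolding normalizer_def
  proof (intro subsetI CollectI conjI ballI)
    fix v b assume "v \<in> V" "b \<in> B"
    then show "v * b * star v \<in> B" by (intro VV VB)
    have "star v * (b * v) \<in> B" using \<open>v \<in> V\<close> \<open>b \<in> B\<close> by (intro VV BV)
    then show "star v * b * v \<in> B" by (simp add: mult.assoc)
  qed
  have "sigma_map B v \<subseteq> V" if "v \<in> V" for v
    by (rule sigma_least[OF V1]) (intro VB BV that)
  then have "mjoin (sigma_map B ` V) \<subseteq> V"
    unfolding mjoin_def by (intro closure_cspan_least V1) auto
  moreover have "V \<subseteq> mjoin (sigma_map B ` V)"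
  proof
    fix v assume v: "v \<in> V"
    then have "v \<in> \<Union> (sigma_map B ` V)" using self_in_sigma[OF VV(2,1)] by blast
    then show "v \<in> mjoin (sigma_map B ` V)"
      unfolding mjoin_def by (rule subsetD[OF closure_cspan_superset])
  qed
  ultimately show "V = mjoin (sigma_map B ` V)" by blast
qed

lemma image_sigma_join_dense: "join_dense (sigma_map B ` normalizer B) (pseudogroup B)"
  unfolding join_dense_def
proof (intro conjI ballI exI)
  show "sigma_map B ` normalizer B \<subseteq> pseudogroup B"
    using sigma_in_pseudogroup by blast
  fix V assume "V \<in> pseudogroup B"
  note V = pseudogroup_join_of_sigma[OF this]
  show "V = mjoin (sigma_map B ` V)" by (rule V)
  show "sigma_map B ` V \<subseteq> sigma_map B ` normalizer B" by (rule image_mono[OF V(1)])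
qed

section \<open>Commutative coefficients\<close>

text \<open>
  A sharper factorisation, placing \<open>y\<^sup>*y\<close> next to \<open>y\<close>. In commutative \<open>B\<close> the closed ideal
  \<open>J\<close> generated by \<open>h = y\<^sup>*y\<close> is again a closed self-adjoint subalgebra. It contains \<open>h\<close>, by the
  factorisation of \<open>h\<close> itself (\<open>h\<^sup>*h = h\<^sup>2 \<in> B\<close>), so the factorisation of \<open>y\<close> may be taken with
  coefficients in \<open>J\<close>.
\<close>

lemma factors_through_cube:
  assumes comm: "\<And>a b. a \<in> B \<Longrightarrow> b \<in> B \<Longrightarrow> a * b = b * a" and y: "star y * y \<in> B"
  shows "y \<in> closure ((\<lambda>b. y * star y * y * b) ` B)"
proof -
  define h where "h = star y * y"
  have h: "h \<in> B" "star h = h" using y by (simp_all add: h_def star_mult star_star)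
  define J where "J = closure ((\<lambda>b. h * b) ` B)"
  have J: "closed_star_subalgebra J"
    unfolding closed_star_subalgebra_def
  proof (intro conjI ballI)
    show "csubspace J"
      unfolding J_def line_mprod[OF BD(1), symmetric] mprod_def by (rule csubspace_closure_cspan)
    show "closed J" by (simp add: J_def)
    show "a * b \<in> J" if "a \<in> J" "b \<in> J" for a b
    proof (rule closure_mult_closed)
      show "closed J" by (simp add: J_def)
      show "a \<in> closure ((\<lambda>b. h * b) ` B)" "b \<in> closure ((\<lambda>b. h * b) ` B)"
        using that by (simp_all add: J_def)
      fix s t assume "s \<in> (\<lambda>b. h * b) ` B" "t \<in> (\<lambda>b. h * b) ` B"
      then obtain c d where "c \<in> B" "d \<in> B" "s * t = h * (c * (h * d))"
        by (auto simp: mult.assoc)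
      then have "s * t \<in> (\<lambda>b. h * b) ` B" using h BD(3) by blast
      then show "s * t \<in> J" unfolding J_def by (rule subsetD[OF closure_subset])
    qed
    have "mstar J = B \<odot> line h"
      unfolding J_def line_mprod[OF BD(1), symmetric]
      by (simp add: mstar_mprod mstar_line mstar_subalgebra h)
    also have "\<dots> = J"
      unfolding J_def mprod_line[OF BD(1)] using comm[OF h(1)] by (simp cong: image_cong)
    finally show "star a \<in> J" if "a \<in> J" for a
      using that by (auto simp: mstar_def)
  qed
  have "h \<in> J"
    unfolding J_def by (rule in_closure_right_multiples[OF B]) (use h BD(3) in simp)
  then have "y \<in> closure ((\<lambda>c. y * c) ` J)"
    using in_closure_right_multiples[OF J, of y] by (simp add: h_def)
  moreover have "(\<lambda>c. y * c) ` J \<subseteq> closure ((\<lambda>c. y * c) ` (\<lambda>b. h * b) ` B)"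
    unfolding J_def by (intro image_closure_subset closed_closure closure_subset continuous_intros)
  then have "closure ((\<lambda>c. y * c) ` J) \<subseteq> closure ((\<lambda>c. y * c) ` (\<lambda>b. h * b) ` B)"
    by (rule closure_minimal[OF _ closed_closure])
  ultimately have "y \<in> closure ((\<lambda>c. y * c) ` (\<lambda>b. h * b) ` B)" by blast
  then show ?thesis by (simp add: image_image h_def mult.assoc)
qed

text \<open>
  The inclusion of \<open>nB\<close> in \<open>BnB\<close> is the factorisation of \<open>nb\<close> on the left. For the
  converse, factor \<open>y = nb'\<close> through \<open>yy\<^sup>*y\<close> and move \<open>b\<close> past \<open>yy\<^sup>*\<close>.
\<close>

lemma sigma_eq_line_mprod:
  assumes comm: "\<And>a b. a \<in> B \<Longrightarrow> b \<in> B \<Longrightarrow> a * b = b * a" and n: "n \<in> normalizer B"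
  shows "sigma_map B n = line n \<odot> B"
proof
  show "line n \<odot> B \<subseteq> sigma_map B n"
    unfolding line_mprod[OF BD(1)]
  proof (intro closure_minimal closed_sigma image_subsetI)
    fix b assume b: "b \<in> B"
    have "(\<lambda>c. c * (n * b)) ` B \<subseteq> sigma_map B n"
      using b mult_in_sigma by (auto simp: mult.assoc)
    then show "n * b \<in> sigma_map B n"
      using right_mult_normalizer_factors[OF n b] closure_minimal[OF _ closed_sigma] by blast
  qed
  show "sigma_map B n \<subseteq> line n \<odot> B"
  proof (rule sigma_least)
    show "csubspace (line n \<odot> B)" "closed (line n \<odot> B)"
      by (simp_all add: mprod_def csubspace_closure_cspan)
    fix b b' assume b: "b \<in> B" "b' \<in> B"
    define y where "y = n * b'"
    have yy: "y * star y \<in> B"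
      using normalizerD(3)[OF n, of "b' * star b'"] b BD by (simp add: y_def star_mult mult.assoc)
    have ycy: "star y * (c * y) \<in> B" if "c \<in> B" for c
    proof -
      have "star b' * (star n * c * n) * b' \<in> B" using n b that BD by (intro BD(3) normalizerD) simp_all
      then show ?thesis by (simp add: y_def star_mult mult.assoc)
    qed
    \<comment> \<open>The normalizer condition does not give \<open>n\<^sup>*n \<in> B\<close>; but \<open>y\<close> is a limit of elements \<open>cy\<close> with
      \<open>c \<in> B\<close>, so \<open>y\<^sup>*y\<close> is a limit of elements \<open>y\<^sup>*cy\<close>.\<close>
    have "star y * y \<in> B"
      by (rule closure_mult_closed[OF BD(2) _ in_closure_left_multiples[OF B yy], of _ "{star y}"])
        (use ycy in auto)
    note cube = factors_through_cube[OF comm this]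
    have "b * y \<in> line n \<odot> B"
    proof (rule closure_mult_closed[OF _ _ cube, of _ _ "{b}"])
      show "closed (line n \<odot> B)" by (simp add: mprod_def)
      fix s t assume "s \<in> {b}" "t \<in> (\<lambda>c. y * star y * y * c) ` B"
      then obtain g where g: "g \<in> B" "s * t = b * (y * star y) * y * g"
        by (auto simp: mult.assoc)
      note g(2)
      also have "b * (y * star y) * y * g = n * (b' * (star y * (b * y)) * g)"
        unfolding comm[OF b(1) yy] by (simp add: y_def mult.assoc)
      finally have "s * t = n * (b' * (star y * (b * y)) * g)" .
      moreover have "b' * (star y * (b * y)) * g \<in> B"
        by (intro BD(3) ycy b g(1))
      ultimately have "s * t \<in> (\<lambda>c. n * c) ` B" by (rule image_eqI)
      then show "s * t \<in> line n \<odot> B"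
        unfolding line_mprod[OF BD(1)] by (rule subsetD[OF closure_subset])
    qed simp
    then show "b * n * b' \<in> line n \<odot> B" by (simp add: y_def mult.assoc)
  qed
qed

lemma sigma_eq_mprod_line:
  assumes comm: "\<And>a b. a \<in> B \<Longrightarrow> b \<in> B \<Longrightarrow> a * b = b * a" and n: "n \<in> normalizer B"
  shows "sigma_map B n = B \<odot> line n"
proof -
  have "mstar (line (star n) \<odot> B) = B \<odot> line n"
    by (simp add: mstar_mprod mstar_line star_star mstar_subalgebra)
  moreover have "sigma_map B (star n) = line (star n) \<odot> B"
    by (rule sigma_eq_line_mprod[OF comm normalizer_star[OF n]])
  ultimately show ?thesis
    using sigma_star[of "star n"] by (simp only: star_star)
qed

lemma sigma_mult:
  assumes comm: "\<And>a b. a \<in> B \<Longrightarrow> b \<in> B \<Longrightarrow> a * b = b * a"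
    and m: "m \<in> normalizer B" and n: "n \<in> normalizer B"
  shows "sigma_map B (m * n) = sigma_map B m \<odot> sigma_map B n"
proof
  show "sigma_map B m \<odot> sigma_map B n \<subseteq> sigma_map B (m * n)"
  proof (rule mprod_least[OF csubspace_sigma closed_sigma])
    fix v w assume "v \<in> sigma_map B m" "w \<in> sigma_map B n"
    then have "v \<in> closure ((\<lambda>b. b * m) ` B)" "w \<in> closure ((\<lambda>b. n * b) ` B)"
      using sigma_eq_mprod_line[OF comm m] sigma_eq_line_mprod[OF comm n]
      by (simp_all add: mprod_line[OF BD(1)] line_mprod[OF BD(1)])
    then show "v * w \<in> sigma_map B (m * n)"
    proof (rule closure_mult_closed[OF closed_sigma], clarify)
      fix b b' assume "b \<in> B" "b' \<in> B"
      then show "b * m * (n * b') \<in> sigma_map B (m * n)"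
        using mult_in_sigma[of b b' "m * n"] by (simp add: mult.assoc)
    qed
  qed
qed (rule sigma_mult_subset[OF m n])

end

theorem theorem6p2:
  fixes B :: "'a::cstar_algebra set"
  assumes "closed_star_subalgebra B"
  shows "(\<forall>n\<in>normalizer B. sigma_map B n \<in> pseudogroup B)
    \<and> (\<forall>m\<in>normalizer B. \<forall>n\<in>normalizer B. sigma_map B (m * n) \<subseteq> sigma_map B m \<odot> sigma_map B n)
    \<and> (\<forall>n\<in>normalizer B. sigma_map B (star n) = mstar (sigma_map B n))
    \<and> (contains_approximate_unit B \<longrightarrow> join_dense (sigma_map B ` normalizer B) (pseudogroup B))
    \<and> ((\<forall>a\<in>B. \<forall>b\<in>B. a * b = b * a) \<longrightarrow>
         (\<forall>m\<in>normalizer B. \<forall>n\<in>normalizer B. sigma_map B (m * n) = sigma_map B m \<odot> sigma_map B n)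
         \<and> (\<forall>n\<in>normalizer B. sigma_map B n = line n \<odot> B \<and> sigma_map B n = B \<odot> line n))"
  by (intro conjI ballI impI sigma_in_pseudogroup[OF assms] sigma_mult_subset[OF assms]
      sigma_star[OF assms] image_sigma_join_dense[OF assms] sigma_mult[OF assms]
      sigma_eq_line_mprod[OF assms] sigma_eq_mprod_line[OF assms]) simp_all

end
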